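(* In the setting of the context, suppose that $Y=\hat Y$, $\mathcal V$ is sufficient, $A=I-K\in L(Y)$, $A_n=I-K_n\in L(Y)$ for $n\in\mathbb N$, and that: (a) $A_n\stackrel{s}{\to}A$; (b) for each $n\in\mathbb N$, if $A_n$ is bounded below then $A_n$ is surjective; (c) $\{V_{-k}K_nV_k:k\in\mathbb Z^N,\ n\in\mathbb N\}$ is uniformly Montel on $(Y,s)$; (d) there exists a set $\mathcal B\subset L(Y)$ such that, for every sequence $(k(m))\subset\mathbb Z^N$ and increasing sequence $(n(m))\subset\mathbb N$, there exist subsequences, denoted again by $(k(m))$ and $(n(m))$, and $B\in\mathcal B$ such that $V_{-k(m)}A_{n(m)}V_{k(m)}\stackrel{s}{\to}B$ as $m\to\infty$; (e) every $B\in\mathcal B$ is injective. Then $A$ is invertible and, for some $n_0\in\mathbb N$, $A_n$ is invertible for all $n\ge n_0$, and $$\|A^{-1}\|\le\sup_{n\ge n_0}\|A_n^{-1}\|<\infty.$$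
   Context: $Y$ is a real or complex Banach space, $L(Y)$ the bounded linear operators on $Y$. $\mathcal P=(P_n)_{n=0}^\infty\subset L(Y)$ satisfies: (i) $\sup_n\|P_nx\|=\|x\|$ for all $x\in Y$; (ii) for every $m\in\mathbb N_0$ there is $N(m)\ge m$ with $P_nP_m=P_m=P_mP_n$ for all $n\ge N(m)$. $Q_n:=I-P_n$, $|x|_n:=\max_{0\le m\le n}\|P_mx\|$. The strict topology on $Y$ is generated by the seminorms $|x|_a:=\sup_n a(n)|x|_n$, $a$ running through all positive null sequences; $(Y,s)$ denotes $Y$ with this topology. Strict convergence $x_n\stackrel{s}{\to}x$ holds iff $\sup_n\|x_n\|<\infty$ and $\|P_m(x_n-x)\|\to0$ for every $m$. Let $X$ be the completion of $Y$ with respect to the family of seminorms $\{|\cdot|_n\}$ and $\hat Y:=\{x\in X:\sup_n|x|_n<\infty\}$. The condition $Y=\hat Y$ is equivalent to sequential completeness of $(Y,s)$: every norm-bounded sequence $(x_n)\subset Y$ for which $(P_mx_n)_n$ is norm-Cauchy for each $m$ converges strictly to an element of $Y$. For operators, $A_n\stackrel{s}{\to}A$ means: $x_n\stackrel{s}{\to}x\Rightarrow A_nx_n\stackrel{s}{\to}Ax$. A set $\mathcal K$ of linear operators is uniformly Montel on $(Y,s)$ if $\bigcup_{K\in\mathcal K}K(B)$ is relatively compact in the strict topology for every bounded $B\subset Y$ (equivalently, for all $(K_n)\subset\mathcal K$ and bounded $(x_n)\subset Y$, $(K_nx_n)$ has a strictly convergent subsequence). $A$ is bounded below if $\inf_{\|x\|=1}\|Ax\|>0$.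 For some $N\in\mathbb N$, $\mathcal V=\{V_k\}_{k\in\mathbb Z^N}$ is a group of linear isometries on $Y$ with $V_0=I$, $V_kV_m=V_{k+m}$, such that: for all $m,n\in\mathbb N$ there is $k_0$ with $P_mV_kP_n=0$ if $|k|>k_0$; and for all $m\in\mathbb N$, $k\in\mathbb Z^N$ there is $n_0$ with $P_mV_kQ_n=0=Q_nV_kP_m$ if $n>n_0$. $\mathcal V$ is sufficient if there is $n\in\mathbb N$ such that for every $x\in Y$ there is $V\in\mathcal V$ with $2|Vx|_n\ge\|x\|$. *)

theory Defs
  imports "HOL-Analysis.Analysis"
begin

text \<open>
  Scalars are a type of class \<open>real_normed_field\<close>. By the Gelfand-Mazur theorem the only such
  fields are the real and the complex numbers, so \<open>banach_over\<close> describes exactly the real and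
  the complex Banach spaces. The class \<open>banach\<close> supplies the norm, its completeness and the
  underlying real vector space.
\<close>

locale banach_over = vector_space smul
  for smul :: "'k::real_normed_field \<Rightarrow> 'a::banach \<Rightarrow> 'a" +
  assumes norm_scale: "norm (smul c x) = norm c * norm x"
    and scale_of_real: "smul (of_real r) x = r *\<^sub>R x"

lemma banach_over_scaleR: "banach_over (scaleR :: real \<Rightarrow> 'a::banach \<Rightarrow> 'a)"
  by unfold_locales (auto simp: algebra_simps)

definition bounded_ops :: "('k \<Rightarrow> 'a::real_normed_vector \<Rightarrow> 'a) \<Rightarrow> ('a \<Rightarrow>\<^sub>L 'a) set" where
  "bounded_ops smul = {T. \<forall>c x. blinfun_apply T (smul c x) = smul c (blinfun_apply T x)}"

locale approximate_projections = banach_over smul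
  for smul :: "'k::real_normed_field \<Rightarrow> 'a::banach \<Rightarrow> 'a" +
  fixes P :: "nat \<Rightarrow> 'a \<Rightarrow>\<^sub>L 'a"
  assumes P_op: "P n \<in> bounded_ops smul"
    and P_sup: "(SUP n. ereal (norm (P n x))) = ereal (norm x)"
    and P_absorb: "\<exists>N\<ge>m. \<forall>n\<ge>N. P n o\<^sub>L P m = P m \<and> P m o\<^sub>L P n = P m"

definition co_proj :: "(nat \<Rightarrow> 'a::real_normed_vector \<Rightarrow>\<^sub>L 'a) \<Rightarrow> nat \<Rightarrow> 'a \<Rightarrow>\<^sub>L 'a" where
  "co_proj P n = id_blinfun - P n"

definition local_norm :: "(nat \<Rightarrow> 'a::real_normed_vector \<Rightarrow>\<^sub>L 'a) \<Rightarrow> nat \<Rightarrow> 'a \<Rightarrow> real" where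
  "local_norm P n x = Max ((\<lambda>m. norm (P m x)) ` {0..n})"

definition positive_null :: "(nat \<Rightarrow> real) \<Rightarrow> bool" where
  "positive_null a \<longleftrightarrow> (\<forall>n. 0 < a n) \<and> a \<longlonglongrightarrow> 0"

definition strict_seminorm ::
    "(nat \<Rightarrow> 'a::real_normed_vector \<Rightarrow>\<^sub>L 'a) \<Rightarrow> (nat \<Rightarrow> real) \<Rightarrow> 'a \<Rightarrow> real" where
  "strict_seminorm P a x = (SUP n. a n * local_norm P n x)"

definition strict_topology ::
    "(nat \<Rightarrow> 'a::real_normed_vector \<Rightarrow>\<^sub>L 'a) \<Rightarrow> 'a topology" where
  "strict_topology P = topology_generated_by
     {{y. strict_seminorm P a (y - x) < e} | a x e. positive_null a \<and> 0 < e}"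

definition strict_conv ::
    "(nat \<Rightarrow> 'a::real_normed_vector \<Rightarrow>\<^sub>L 'a) \<Rightarrow> (nat \<Rightarrow> 'a) \<Rightarrow> 'a \<Rightarrow> bool" where
  "strict_conv P x l \<longleftrightarrow> limitin (strict_topology P) x l sequentially"

definition strict_op_conv ::
    "(nat \<Rightarrow> 'a::real_normed_vector \<Rightarrow>\<^sub>L 'a) \<Rightarrow> (nat \<Rightarrow> 'a \<Rightarrow>\<^sub>L 'a) \<Rightarrow> ('a \<Rightarrow>\<^sub>L 'a) \<Rightarrow> bool" where
  "strict_op_conv P A B \<longleftrightarrow>
     (\<forall>x l. strict_conv P x l \<longrightarrow> strict_conv P (\<lambda>n. A n (x n)) (B l))"

definition uniformly_Montel ::
    "(nat \<Rightarrow> 'a::real_normed_vector \<Rightarrow>\<^sub>L 'a) \<Rightarrow> ('a \<Rightarrow>\<^sub>L 'a) set \<Rightarrow> bool" where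
  "uniformly_Montel P \<K> \<longleftrightarrow>
     (\<forall>S. bounded S \<longrightarrow>
        compactin (strict_topology P)
          (strict_topology P closure_of (\<Union>K\<in>\<K>. blinfun_apply K ` S)))"

text \<open>
  The completion with respect to the seminorms \<open>local_norm P n\<close> consists of the equivalence
  classes of sequences that are Cauchy for each of these seminorms, two sequences being
  equivalent if their difference tends to zero in each of them. The seminorms extend to the
  completion as limits along representatives, and the space itself embeds by constant sequences.
\<close>

definition local_Cauchy :: "(nat \<Rightarrow> 'a::real_normed_vector \<Rightarrow>\<^sub>L 'a) \<Rightarrow> (nat \<Rightarrow> 'a) set" where
  "local_Cauchy P =
     {x. \<forall>n. \<forall>e>0. \<exists>M. \<forall>i\<ge>M. \<forall>j\<ge>M. local_norm P n (x i - x j) < e}"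

definition local_equiv ::
    "(nat \<Rightarrow> 'a::real_normed_vector \<Rightarrow>\<^sub>L 'a) \<Rightarrow> ((nat \<Rightarrow> 'a) \<times> (nat \<Rightarrow> 'a)) set" where
  "local_equiv P = {(x, y). x \<in> local_Cauchy P \<and> y \<in> local_Cauchy P \<and>
     (\<forall>n. (\<lambda>j. local_norm P n (x j - y j)) \<longlonglongrightarrow> 0)}"

definition completion ::
    "(nat \<Rightarrow> 'a::real_normed_vector \<Rightarrow>\<^sub>L 'a) \<Rightarrow> (nat \<Rightarrow> 'a) set set" where
  "completion P = local_Cauchy P // local_equiv P"

definition completion_norm ::
    "(nat \<Rightarrow> 'a::real_normed_vector \<Rightarrow>\<^sub>L 'a) \<Rightarrow> nat \<Rightarrow> (nat \<Rightarrow> 'a) set \<Rightarrow> real" where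
  "completion_norm P n \<xi> = (THE r. \<forall>x\<in>\<xi>. (\<lambda>j. local_norm P n (x j)) \<longlonglongrightarrow> r)"

definition completion_embed ::
    "(nat \<Rightarrow> 'a::real_normed_vector \<Rightarrow>\<^sub>L 'a) \<Rightarrow> 'a \<Rightarrow> (nat \<Rightarrow> 'a) set" where
  "completion_embed P y = local_equiv P `` {\<lambda>_. y}"

definition hat_space ::
    "(nat \<Rightarrow> 'a::real_normed_vector \<Rightarrow>\<^sub>L 'a) \<Rightarrow> (nat \<Rightarrow> 'a) set set" where
  "hat_space P = {\<xi> \<in> completion P. (SUP n. ereal (completion_norm P n \<xi>)) < \<infinity>}"

definition equals_hat_space :: "(nat \<Rightarrow> 'a::real_normed_vector \<Rightarrow>\<^sub>L 'a) \<Rightarrow> bool" where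
  "equals_hat_space P \<longleftrightarrow> range (completion_embed P) = hat_space P"

definition index_norm :: "int ^ 'n::finite \<Rightarrow> int" where
  "index_norm k = Max (range (\<lambda>i. \<bar>k $ i\<bar>))"

locale isometry_group = approximate_projections smul P
  for smul :: "'k::real_normed_field \<Rightarrow> 'a::banach \<Rightarrow> 'a"
    and P :: "nat \<Rightarrow> 'a \<Rightarrow>\<^sub>L 'a" +
  fixes V :: "int ^ 'n::finite \<Rightarrow> 'a \<Rightarrow>\<^sub>L 'a"
  assumes V_op: "V k \<in> bounded_ops smul"
    and V_isometry: "norm (V k x) = norm x"
    and V_zero: "V 0 = id_blinfun"
    and V_add: "V (k + l) = V k o\<^sub>L V l"
    and V_far: "\<lbrakk>m \<ge> 1; n \<ge> 1\<rbrakk> \<Longrightarrow>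
      \<exists>k0. \<forall>k. index_norm k > k0 \<longrightarrow> P m o\<^sub>L V k o\<^sub>L P n = 0"
    and V_local: "m \<ge> 1 \<Longrightarrow>
      \<exists>n0. \<forall>n>n0. P m o\<^sub>L V k o\<^sub>L co_proj P n = 0 \<and> co_proj P n o\<^sub>L V k o\<^sub>L P m = 0"

definition sufficient ::
    "(nat \<Rightarrow> 'a::real_normed_vector \<Rightarrow>\<^sub>L 'a) \<Rightarrow> (int ^ 'n::finite \<Rightarrow> 'a \<Rightarrow>\<^sub>L 'a) \<Rightarrow> bool" where
  "sufficient P V \<longleftrightarrow> (\<exists>n\<ge>1. \<forall>x. \<exists>k. 2 * local_norm P n (V k x) \<ge> norm x)"

text \<open>
  The infimum is taken in the extended reals, so that on the zero space, where it ranges over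
  the empty set, it is \<open>\<infinity>\<close>.
\<close>

definition bounded_below :: "('a::real_normed_vector \<Rightarrow>\<^sub>L 'a) \<Rightarrow> bool" where
  "bounded_below A \<longleftrightarrow> (INF x\<in>{x. norm x = 1}. ereal (norm (A x))) > 0"

definition is_op_inverse ::
    "('k \<Rightarrow> 'a::real_normed_vector \<Rightarrow> 'a) \<Rightarrow> ('a \<Rightarrow>\<^sub>L 'a) \<Rightarrow> ('a \<Rightarrow>\<^sub>L 'a) \<Rightarrow> bool" where
  "is_op_inverse smul A B \<longleftrightarrow>
     B \<in> bounded_ops smul \<and> A o\<^sub>L B = id_blinfun \<and> B o\<^sub>L A = id_blinfun"

definition op_invertible ::
    "('k \<Rightarrow> 'a::real_normed_vector \<Rightarrow> 'a) \<Rightarrow> ('a \<Rightarrow>\<^sub>L 'a) \<Rightarrow> bool" where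
  "op_invertible smul A \<longleftrightarrow> (\<exists>B. is_op_inverse smul A B)"

definition op_inverse ::
    "('k \<Rightarrow> 'a::real_normed_vector \<Rightarrow> 'a) \<Rightarrow> ('a \<Rightarrow>\<^sub>L 'a) \<Rightarrow> 'a \<Rightarrow>\<^sub>L 'a" where
  "op_inverse smul A = (THE B. is_op_inverse smul A B)"

end

theory Submission
  imports Defs
begin

text \<open>
  Everything rests on one description of the strict topology: a sequence converges strictly if and
  only if it is norm bounded and converges after applying each \<open>P m\<close> (\<open>strict_conv_iff\<close>). With it,
  strictly compact sets are norm bounded and sequentially compact, so the uniform Montel condition
  provides strictly convergent subsequences (\<open>uniformly_Montel_imp_subseq\<close>), although the strict
  topology need not be metrizable.

  The operators \<open>An n\<close> are uniformly bounded below for large \<open>n\<close> (\<open>uniformly_bounded_below\<close>).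
  Otherwise there are unit vectors \<open>x m\<close> with \<open>An (\<nu> m) (x m)\<close> tending to zero in norm along an increasing
  \<open>\<nu>\<close>. Strict limits cannot see mass that escapes to infinity, but sufficiency of the group moves
  each \<open>x m\<close> to a vector \<open>y m\<close> whose local norm, for one fixed index, is at least \<open>1/2\<close>. The
  translated operators tend to some injective \<open>B\<close> along a subsequence, and as they differ from the
  identity by a collectively compact family and annihilate \<open>y m\<close> asymptotically, a subsequence of
  \<open>y\<close> has a strict limit \<open>l\<close>. Then \<open>B l = 0\<close>, while \<open>l\<close> is nonzero by the local norm bound.

  Bounded below and hence surjective, \<open>An n\<close> has an inverse with a bound independent of \<open>n\<close>. Norms
  are only lower semicontinuous under strict limits, so a lower bound for \<open>A\<close> cannot be read off from
  those for \<open>An n\<close>. Instead, injectivity of \<open>A\<close> holds because \<open>A\<close> is itself a member of \<open>\<B>\<close>, and the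
  solutions of \<open>An n x = y\<close> have a strictly convergent subsequence whose limit solves \<open>A x = y\<close>
  (\<open>limit_preimage_bound\<close>). Lower semicontinuity now works in the right direction: it bounds the
  norm of this solution, and thus of the inverse of \<open>A\<close>, by the supremum of the inverses' norms.
\<close>

section \<open>Local norms and strict seminorms\<close>

context approximate_projections
begin

lemma norm_P_le: "norm (P n x) \<le> norm x"
proof -
  have "ereal (norm (P n x)) \<le> (SUP n. ereal (norm (P n x)))"
    by (rule SUP_upper) simp
  then show ?thesis unfolding P_sup by simp
qed

lemma norm_le_if_P_le:
  assumes "\<And>n. norm (P n x) \<le> C"
  shows "norm x \<le> C"
proof -
  have "(SUP n. ereal (norm (P n x))) \<le> ereal C"
    using assms by (intro SUP_least) simp
  then show ?thesis unfolding P_sup by simp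
qed

lemma eq_if_P_eq:
  assumes "\<And>n. P n x = P n y"
  shows "x = y"
  using norm_le_if_P_le[of "x - y" 0] assms by (simp add: blinfun.diff_right)

lemma local_norm_le_iff: "local_norm P n x \<le> C \<longleftrightarrow> (\<forall>m\<le>n. norm (P m x) \<le> C)"
  unfolding local_norm_def by (subst Max_le_iff) auto

lemma norm_P_le_local_norm: "m \<le> n \<Longrightarrow> norm (P m x) \<le> local_norm P n x"
  using local_norm_le_iff[of n x "local_norm P n x"] by auto

lemma local_norm_nonneg: "0 \<le> local_norm P n x"
  using norm_P_le_local_norm[of 0 n x] norm_ge_zero order_trans by blast

lemma local_norm_le_norm: "local_norm P n x \<le> norm x"
  by (simp add: local_norm_le_iff norm_P_le)

lemma local_norm_mono: "m \<le> n \<Longrightarrow> local_norm P m x \<le> local_norm P n x"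
  by (simp add: local_norm_le_iff norm_P_le_local_norm)

lemma local_norm_triangle: "local_norm P n (x + y) \<le> local_norm P n x + local_norm P n y"
  unfolding local_norm_le_iff
  by (auto simp: blinfun.add_right intro!: norm_triangle_mono norm_P_le_local_norm)

lemma strict_seminorm_bdd:
  assumes "positive_null a"
  shows "bdd_above (range (\<lambda>n. a n * local_norm P n x))"
proof -
  from assms have "convergent a" and pos: "\<And>n. 0 < a n"
    by (auto simp: positive_null_def convergent_def)
  then obtain C where C: "\<And>n. norm (a n) \<le> C"
    using convergent_imp_Bseq BseqE by metis
  have "a n * local_norm P n x \<le> C * norm x" for n
    using C[of n] pos[of n] by (intro mult_mono local_norm_le_norm local_norm_nonneg) auto
  then show ?thesis by (auto simp: bdd_above_def)
qed

lemma le_strict_seminorm: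
  "positive_null a \<Longrightarrow> a n * local_norm P n x \<le> strict_seminorm P a x"
  unfolding strict_seminorm_def by (rule cSUP_upper) (auto intro: strict_seminorm_bdd)

lemma strict_seminorm_le:
  "(\<And>n. a n * local_norm P n x \<le> C) \<Longrightarrow> strict_seminorm P a x \<le> C"
  unfolding strict_seminorm_def by (rule cSUP_least) auto

lemma strict_seminorm_triangle:
  assumes "positive_null a"
  shows "strict_seminorm P a (x + y) \<le> strict_seminorm P a x + strict_seminorm P a y"
proof (rule strict_seminorm_le)
  fix n
  have "a n * local_norm P n (x + y) \<le> a n * (local_norm P n x + local_norm P n y)"
    using assms by (intro mult_left_mono local_norm_triangle) (auto simp: positive_null_def less_imp_le)
  also have "\<dots> \<le> strict_seminorm P a x + strict_seminorm P a y"
    using le_strict_seminorm[OF assms] by (simp add: distrib_left add_mono)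
  finally show "a n * local_norm P n (x + y) \<le> strict_seminorm P a x + strict_seminorm P a y" .
qed

lemma strict_seminorm_zero: "positive_null a \<Longrightarrow> strict_seminorm P a 0 = 0"
  using le_strict_seminorm[of a 0 0] strict_seminorm_le[of a 0 0]
  by (simp add: local_norm_def image_constant_conv)

lemma positive_null_inverse_Suc: "positive_null (\<lambda>n. 1 / real (Suc n))"
  using LIMSEQ_Suc[OF lim_1_over_n] by (simp add: positive_null_def)

lemma positive_null_exists: "\<exists>a. positive_null a"
  using positive_null_inverse_Suc by blast

text \<open>
  The weight \<open>a n = 1 / sqrt (1 + g n)\<close> with \<open>g n\<close> the supremum of \<open>local_norm P n\<close> over \<open>S\<close>
  tests boundedness: were \<open>g\<close> unbounded, \<open>a\<close> would be a null sequence, and a bound \<open>M\<close> for its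
  seminorm on \<open>S\<close> would give \<open>g n \<le> M * sqrt (1 + g n)\<close>, which keeps \<open>g\<close> bounded.
\<close>

lemma bounded_if_strict_seminorms_bounded:
  assumes bd: "\<And>a. positive_null a \<Longrightarrow> \<exists>M. \<forall>x\<in>S. strict_seminorm P a x \<le> M"
  shows "bounded S"
proof (rule ccontr)
  assume unbounded: "\<not> bounded S"
  then have ne: "S \<noteq> {}" by auto
  note null = positive_null_inverse_Suc
  define g where "g n = (SUP x\<in>S. local_norm P n x)" for n
  obtain M0 where M0: "\<And>x. x \<in> S \<Longrightarrow> strict_seminorm P (\<lambda>n. 1 / real (Suc n)) x \<le> M0"
    using bd[OF null] by blast
  have bdd: "bdd_above (local_norm P n ` S)" for n
  proof -
    have "local_norm P n x \<le> M0 * real (Suc n)" if "x \<in> S" for x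
    proof -
      have "local_norm P n x / real (Suc n) \<le> M0"
        using le_strict_seminorm[OF null, of n x] M0[OF that] by simp
      then show ?thesis by (simp add: divide_le_eq)
    qed
    then show ?thesis by (auto simp: bdd_above_def)
  qed
  have le_g: "local_norm P n x \<le> g n" if "x \<in> S" for n x
    unfolding g_def using that bdd by (rule cSUP_upper)
  have g_nonneg: "0 \<le> g n" for n
    using ne le_g local_norm_nonneg order_trans by blast
  have g_mono: "g m \<le> g n" if "m \<le> n" for m n
    unfolding g_def[of m] using ne
  proof (rule cSUP_least)
    fix x assume "x \<in> S"
    then show "local_norm P m x \<le> g n"
      using local_norm_mono[OF that, of x] le_g[of x n] by linarith
  qed
  have "filterlim g at_top sequentially"
    unfolding filterlim_at_top eventually_sequentially
  proof
    fix Z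
    have "\<not> (\<forall>x\<in>S. norm x \<le> Z)" using unbounded by (auto simp: bounded_iff)
    then obtain x where x: "x \<in> S" "\<not> norm x \<le> Z" by blast
    then obtain m where "Z < norm (P m x)" using norm_le_if_P_le not_le by blast
    then have "Z \<le> g m" using norm_P_le_local_norm[of m m x] le_g[OF x(1), of m] by linarith
    then show "\<exists>N. \<forall>n\<ge>N. Z \<le> g n" using g_mono order_trans by blast
  qed
  then have "filterlim (\<lambda>n. 1 + g n) at_top sequentially"
    by (rule filterlim_tendsto_add_at_top[OF tendsto_const])
  then have sqrt_top: "filterlim (\<lambda>n. sqrt (1 + g n)) at_top sequentially"
    by (rule filterlim_compose[OF sqrt_at_top])
  then have "(\<lambda>n. 1 / sqrt (1 + g n)) \<longlonglongrightarrow> 0"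
    by (rule tendsto_divide_0[OF tendsto_const filterlim_at_top_imp_at_infinity])
  moreover have "0 < 1 / sqrt (1 + g n)" for n using g_nonneg[of n] by simp
  ultimately have a: "positive_null (\<lambda>n. 1 / sqrt (1 + g n))"
    by (simp add: positive_null_def)
  then obtain M where M: "\<And>x. x \<in> S \<Longrightarrow> strict_seminorm P (\<lambda>n. 1 / sqrt (1 + g n)) x \<le> M"
    using bd by blast
  have sqrt_le: "sqrt (1 + g n) \<le> 1 + M" for n
  proof -
    have s1: "1 \<le> sqrt (1 + g n)" using g_nonneg[of n] by simp
    have "local_norm P n x \<le> M * sqrt (1 + g n)" if "x \<in> S" for x
    proof -
      have "local_norm P n x / sqrt (1 + g n) \<le> M"
        using le_strict_seminorm[OF a, of n x] M[OF that] by simp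
      then show ?thesis using s1 by (simp add: divide_le_eq)
    qed
    then have "g n \<le> M * sqrt (1 + g n)"
      unfolding g_def using ne by (intro cSUP_least) (auto simp: g_def)
    moreover have "sqrt (1 + g n) * sqrt (1 + g n) = 1 + g n"
      using g_nonneg[of n] by simp
    moreover have "(1 + M) * sqrt (1 + g n) = sqrt (1 + g n) + M * sqrt (1 + g n)"
      by (simp add: distrib_right)
    ultimately have "sqrt (1 + g n) * sqrt (1 + g n) \<le> (1 + M) * sqrt (1 + g n)"
      using s1 by linarith
    then show ?thesis by (rule mult_right_le_imp_le) (use s1 in linarith)
  qed
  obtain n where "1 + M < sqrt (1 + g n)"
    using sqrt_top unfolding filterlim_at_top_dense eventually_sequentially by blast
  with sqrt_le[of n] show False by simp
qed

section \<open>Strict convergence and strict compactness\<close>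

lemma openin_strict_ball:
  "positive_null a \<Longrightarrow> 0 < e \<Longrightarrow>
    openin (strict_topology P) {y. strict_seminorm P a (y - x) < e}"
  unfolding strict_topology_def by (rule topology_generated_by_Basis) blast


lemma topspace_strict_topology [simp]: "topspace (strict_topology P) = UNIV"
proof -
  obtain a where a: "positive_null a" using positive_null_exists by blast
  have "x \<in> topspace (strict_topology P)" for x
    using openin_subset[OF openin_strict_ball[OF a zero_less_one, of x]] strict_seminorm_zero[OF a]
    by auto
  then show ?thesis by auto
qed

lemma strict_conv_iff_seminorms:
  "strict_conv P x l \<longleftrightarrow>
    (\<forall>a e. positive_null a \<longrightarrow> 0 < e \<longrightarrow> (\<forall>\<^sub>F j in sequentially. strict_seminorm P a (x j - l) < e))"
  (is "_ \<longleftrightarrow> ?R")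
proof
  assume conv: "strict_conv P x l"
  show ?R
  proof (intro allI impI)
    fix a and e :: real assume "positive_null a" "0 < e"
    then show "\<forall>\<^sub>F j in sequentially. strict_seminorm P a (x j - l) < e"
      using conv openin_strict_ball[of a e l] strict_seminorm_zero[of a]
      unfolding strict_conv_def limitin_def by auto
  qed
next
  assume R: ?R
  have "\<forall>\<^sub>F j in sequentially. x j \<in> U"
    if "openin (strict_topology P) U" "l \<in> U" for U
  proof -
    from that(1) have "generate_topology_on
        {{y. strict_seminorm P a (y - x) < e} | a x e. positive_null a \<and> 0 < e} U"
      unfolding strict_topology_def openin_topology_generated_by_iff .
    then show ?thesis using that(2)
    proof induction
      case Empty
      then show ?case by simp
    next
      case (Int U W)
      then show ?case by (auto intro: eventually_conj)
    next
      case (UN \<U>)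
      then obtain W where W: "W \<in> \<U>" "l \<in> W" by blast
      with UN.IH have "\<forall>\<^sub>F j in sequentially. x j \<in> W" by blast
      then show ?case by (rule eventually_mono) (use W in blast)
    next
      case (Basis U)
      then obtain a z e where a: "positive_null a" and U: "U = {y. strict_seminorm P a (y - z) < e}"
        by blast
      with Basis have "0 < e - strict_seminorm P a (l - z)" by simp
      with R a have "\<forall>\<^sub>F j in sequentially. strict_seminorm P a (x j - l) < e - strict_seminorm P a (l - z)"
        by blast
      then show ?case
      proof (rule eventually_mono)
        fix j assume "strict_seminorm P a (x j - l) < e - strict_seminorm P a (l - z)"
        then show "x j \<in> U"
          using strict_seminorm_triangle[OF a, of "x j - l" "l - z"] unfolding U by simp
      qed
    qed
  qed
  then show "strict_conv P x l" by (simp add: strict_conv_def limitin_def)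
qed

lemma local_norm_tendsto_zero:
  assumes "\<And>m. (\<lambda>j. P m (x j)) \<longlonglongrightarrow> 0"
  shows "(\<lambda>j. local_norm P n (x j)) \<longlonglongrightarrow> 0"
proof (rule tendsto_sandwich[where f = "\<lambda>_. 0"])
  show "(\<lambda>j. \<Sum>m\<le>n. norm (P m (x j))) \<longlonglongrightarrow> 0"
    using assms by (intro tendsto_null_sum) (simp add: tendsto_norm_zero)
  show "\<forall>\<^sub>F j in sequentially. local_norm P n (x j) \<le> (\<Sum>m\<le>n. norm (P m (x j)))"
    by (intro always_eventually allI, unfold local_norm_le_iff) (auto intro!: member_le_sum)
qed (auto simp: local_norm_nonneg)

text \<open>
  A null sequence \<open>a\<close> makes the tail of the supremum in \<open>strict_seminorm P a\<close> small
  on bounded sets, so that only finitely many local norms matter there. Conversely, a strictly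
  convergent sequence has bounded seminorms, hence bounded norms.
\<close>

lemma strict_conv_iff:
  "strict_conv P x l \<longleftrightarrow> bounded (range x) \<and> (\<forall>m. (\<lambda>j. P m (x j)) \<longlonglongrightarrow> P m l)"
proof
  assume conv: "strict_conv P x l"
  then have ev: "\<forall>\<^sub>F j in sequentially. strict_seminorm P a (x j - l) < e"
    if "positive_null a" "0 < e" for a e
    using that by (auto simp: strict_conv_iff_seminorms)
  have "bounded (range x)"
  proof (rule bounded_if_strict_seminorms_bounded)
    fix a assume a: "positive_null a"
    obtain J where J: "\<And>j. j \<ge> J \<Longrightarrow> strict_seminorm P a (x j - l) < 1"
      using ev[OF a zero_less_one] by (auto simp: eventually_sequentially)
    have tail: "strict_seminorm P a (x j) \<le> 1 + strict_seminorm P a l" if "j \<ge> J" for j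
      using strict_seminorm_triangle[OF a, of "x j - l" l] J[OF that] by simp
    have "strict_seminorm P a (x j) \<le>
        max (1 + strict_seminorm P a l) (Max (insert 0 ((\<lambda>j. strict_seminorm P a (x j)) ` {..<J})))" for j
      using tail[of j] by (cases "j < J") (auto simp: le_max_iff_disj intro!: Max_ge)
    then show "\<exists>M. \<forall>y\<in>range x. strict_seminorm P a y \<le> M" by blast
  qed
  moreover have "(\<lambda>j. P m (x j)) \<longlonglongrightarrow> P m l" for m
  proof (rule LIM_zero_cancel, rule tendstoI)
    fix e :: real assume "0 < e"
    obtain a where a: "positive_null a" using positive_null_exists by blast
    then have am: "0 < a m" by (simp add: positive_null_def)
    from ev[OF a, of "a m * e"] am \<open>0 < e\<close>
    have "\<forall>\<^sub>F j in sequentially. strict_seminorm P a (x j - l) < a m * e" by simp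
    then show "\<forall>\<^sub>F j in sequentially. dist (P m (x j) - P m l) 0 < e"
    proof (rule eventually_mono)
      fix j assume "strict_seminorm P a (x j - l) < a m * e"
      then have "a m * local_norm P m (x j - l) < a m * e"
        using le_strict_seminorm[OF a, of m "x j - l"] by linarith
      then have "local_norm P m (x j - l) < e" using am by simp
      then show "dist (P m (x j) - P m l) 0 < e"
        using norm_P_le_local_norm[of m m "x j - l"] by (simp add: blinfun.diff_right)
    qed
  qed
  ultimately show "bounded (range x) \<and> (\<forall>m. (\<lambda>j. P m (x j)) \<longlonglongrightarrow> P m l)" by blast
next
  assume R: "bounded (range x) \<and> (\<forall>m. (\<lambda>j. P m (x j)) \<longlonglongrightarrow> P m l)"
  then obtain C0 where C0: "\<And>j. norm (x j) \<le> C0" by (auto simp: bounded_iff)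
  define C where "C = C0 + norm l + 1"
  have C: "norm (x j - l) \<le> C" for j
    using norm_triangle_ineq4[of "x j" l] C0[of j] by (simp add: C_def)
  have Cpos: "0 < C" using C0[of 0] norm_ge_zero[of "x 0"] norm_ge_zero[of l]
    unfolding C_def by linarith
  have loc: "(\<lambda>j. local_norm P n (x j - l)) \<longlonglongrightarrow> 0" for n
    by (rule local_norm_tendsto_zero) (use R in \<open>auto simp: blinfun.diff_right intro: LIM_zero\<close>)
  show "strict_conv P x l"
    unfolding strict_conv_iff_seminorms
  proof (intro allI impI)
    fix a and e :: real assume a: "positive_null a" and e: "0 < e"
    then have apos: "\<And>n. 0 < a n" and alim: "a \<longlonglongrightarrow> 0" by (auto simp: positive_null_def)
    have "\<forall>\<^sub>F n in sequentially. a n < e / (2 * C)"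
      using order_tendstoD(2)[OF alim] e Cpos by simp
    then obtain N where N: "\<And>n. n \<ge> N \<Longrightarrow> a n < e / (2 * C)"
      by (auto simp: eventually_sequentially)
    have "\<forall>\<^sub>F j in sequentially. \<forall>n\<in>{..<N}. a n * local_norm P n (x j - l) < e / 2"
    proof (rule eventually_ball_finite, simp, intro ballI)
      fix n
      show "\<forall>\<^sub>F j in sequentially. a n * local_norm P n (x j - l) < e / 2"
        using order_tendstoD(2)[OF tendsto_mult_right_zero[OF loc[of n], of "a n"], of "e / 2"] e by simp
    qed
    then show "\<forall>\<^sub>F j in sequentially. strict_seminorm P a (x j - l) < e"
    proof (rule eventually_mono)
      fix j assume j: "\<forall>n\<in>{..<N}. a n * local_norm P n (x j - l) < e / 2"
      have "strict_seminorm P a (x j - l) \<le> e / 2"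
      proof (rule strict_seminorm_le)
        fix n
        show "a n * local_norm P n (x j - l) \<le> e / 2"
        proof (cases "n < N")
          case True
          with j show ?thesis by (simp add: less_imp_le)
        next
          case False
          then have "a n \<le> e / (2 * C)" using N[of n] by simp
          then have "a n * local_norm P n (x j - l) \<le> e / (2 * C) * C"
            using local_norm_le_norm[of n "x j - l"] C[of j] local_norm_nonneg Cpos e
            by (intro mult_mono) auto
          then show ?thesis using Cpos by simp
        qed
      qed
      then show "strict_seminorm P a (x j - l) < e" using e by simp
    qed
  qed
qed

lemma strict_conv_unique: "strict_conv P x l \<Longrightarrow> strict_conv P x l' \<Longrightarrow> l = l'"
  unfolding strict_conv_iff by (rule eq_if_P_eq) (blast intro: LIMSEQ_unique)

lemma strict_conv_const: "strict_conv P (\<lambda>_. l) l"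
  by (simp add: strict_conv_iff)

lemma strict_conv_subseq:
  assumes "strict_conv P x l" "strict_mono r"
  shows "strict_conv P (\<lambda>j. x (r j)) l"
proof -
  have "bounded (range (\<lambda>j. x (r j)))"
    by (rule bounded_subset[of "range x"]) (use assms(1) in \<open>auto simp: strict_conv_iff\<close>)
  moreover have "(\<lambda>j. P m (x (r j))) \<longlonglongrightarrow> P m l" for m
    using LIMSEQ_subseq_LIMSEQ[of "\<lambda>j. P m (x j)" _ r] assms by (simp add: strict_conv_iff o_def)
  ultimately show ?thesis by (simp add: strict_conv_iff)
qed

lemma strict_conv_add:
  assumes "strict_conv P x l" "strict_conv P y l'"
  shows "strict_conv P (\<lambda>j. x j + y j) (l + l')"
  using assms unfolding strict_conv_iff
  by (auto simp: blinfun.add_right intro: tendsto_add bounded_plus_comp)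

lemma strict_conv_if_norm_conv:
  assumes "x \<longlonglongrightarrow> l"
  shows "strict_conv P x l"
  unfolding strict_conv_iff
  using assms by (auto intro: convergent_imp_bounded blinfun.tendsto tendsto_const)

text \<open>Lower semicontinuity of the norm: it is a supremum of the seminorms given by \<open>P m\<close>.\<close>

lemma norm_strict_limit_le:
  assumes conv: "strict_conv P x l" and le: "\<And>j. norm (x j) \<le> C"
  shows "norm l \<le> C"
proof (rule norm_le_if_P_le)
  fix m
  have "norm (P m (x j)) \<le> C" for j
    using norm_P_le[of m "x j"] le[of j] by linarith
  moreover have "(\<lambda>j. P m (x j)) \<longlonglongrightarrow> P m l" using conv by (simp add: strict_conv_iff)
  ultimately show "norm (P m l) \<le> C"
    by (intro LIMSEQ_le_const2[OF tendsto_norm]) auto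
qed

text \<open>
  Each strict seminorm is bounded on a strictly compact set, as its balls around \<open>0\<close> form an
  increasing open cover.
\<close>

lemma bounded_if_strictly_compact:
  assumes C: "compactin (strict_topology P) C"
  shows "bounded C"
proof (rule bounded_if_strict_seminorms_bounded)
  fix a assume a: "positive_null a"
  define U where "U k = {y. strict_seminorm P a (y - 0) < real (Suc k)}" for k
  have "openin (strict_topology P) (U k)" for k
    unfolding U_def by (rule openin_strict_ball[OF a]) simp
  then have "\<And>W. W \<in> range U \<Longrightarrow> openin (strict_topology P) W" by blast
  moreover have "C \<subseteq> \<Union> (range U)"
  proof
    fix y
    obtain k where "strict_seminorm P a y < real k" using reals_Archimedean2 by blast
    then have "y \<in> U k" by (simp add: U_def)
    then show "y \<in> \<Union> (range U)" by blast
  qed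
  ultimately obtain \<F> where \<F>: "finite \<F>" "\<F> \<subseteq> range U" "C \<subseteq> \<Union>\<F>"
    using C unfolding compactin_def by meson
  then obtain I where I: "finite I" "C \<subseteq> \<Union> (U ` I)"
    using finite_subset_image by metis
  have "strict_seminorm P a y \<le> real (Suc (Max (insert 0 I)))" if "y \<in> C" for y
  proof -
    from that I obtain k where k: "k \<in> I" "y \<in> U k" by blast
    then have "k \<le> Max (insert 0 I)" using I by (intro Max_ge) auto
    with k show ?thesis by (simp add: U_def)
  qed
  then show "\<exists>M. \<forall>y\<in>C. strict_seminorm P a y \<le> M" by blast
qed

text \<open>
  Although the strict topology need not be first countable, on bounded sets a single seminorm with
  an arbitrary weight already controls strict convergence; the balls of this seminorm around a
  cluster point therefore suffice to select a convergent subsequence.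
\<close>

lemma strictly_compact_imp_subseq:
  assumes C: "compactin (strict_topology P) C" and y: "\<And>j::nat. y j \<in> C"
  shows "\<exists>r l. strict_mono r \<and> strict_conv P (\<lambda>j. y (r j)) l"
proof -
  obtain l where cluster: "\<And>U. openin (strict_topology P) U \<Longrightarrow> l \<in> U \<Longrightarrow> infinite {j. y j \<in> U}"
  proof (rule ccontr)
    assume "\<not> thesis"
    then have "\<forall>l. \<exists>U. openin (strict_topology P) U \<and> l \<in> U \<and> finite {j. y j \<in> U}"
      using that by blast
    then obtain U where U: "\<And>l. openin (strict_topology P) (U l)" "\<And>l. l \<in> U l"
        "\<And>l. finite {j. y j \<in> U l}"
      by metis
    have "C \<subseteq> \<Union> (range U)" using U(2) by blast
    then obtain \<F> where \<F>: "finite \<F>" "\<F> \<subseteq> range U" "C \<subseteq> \<Union>\<F>"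
      using C U(1) unfolding compactin_def by (metis (no_types, lifting) imageE)
    have "(UNIV :: nat set) = (\<Union>W\<in>\<F>. {j. y j \<in> W})" using \<F>(3) y by blast
    moreover have "finite (\<Union>W\<in>\<F>. {j. y j \<in> W})" using \<F> U(3) by auto
    ultimately show False by (metis infinite_UNIV_nat)
  qed
  obtain a where a: "positive_null a" using positive_null_exists by blast
  have "\<exists>r. strict_mono r \<and> (\<forall>i. strict_seminorm P a (y (r i) - l) < 1 / real (Suc i))"
  proof -
    have "\<exists>j>j0. strict_seminorm P a (y j - l) < 1 / real (Suc i)" for i and j0 :: nat
    proof -
      have "infinite {j. y j \<in> {z. strict_seminorm P a (z - l) < 1 / real (Suc i)}}"
        using a by (intro cluster openin_strict_ball) (auto simp: strict_seminorm_zero)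
      then show ?thesis by (auto simp: infinite_nat_iff_unbounded)
    qed
    then have "\<exists>r. \<forall>i. strict_seminorm P a (y (r i) - l) < 1 / real (Suc i) \<and> r i < r (Suc i)"
      by (intro dependent_nat_choice) blast+
    then show ?thesis by (auto simp: strict_mono_Suc_iff)
  qed
  then obtain r where r: "strict_mono r"
    and small: "\<And>i. strict_seminorm P a (y (r i) - l) < 1 / real (Suc i)" by blast
  have "(\<lambda>i. P m (y (r i))) \<longlonglongrightarrow> P m l" for m
  proof (rule LIM_zero_cancel, rule Lim_null_comparison)
    have am: "0 < a m" using a by (simp add: positive_null_def)
    show "(\<lambda>i. (1 / a m) * (1 / real (Suc i))) \<longlonglongrightarrow> 0"
      by (rule tendsto_mult_right_zero[OF LIMSEQ_Suc[OF lim_1_over_n]])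
    have "norm (P m (y (r i)) - P m l) \<le> (1 / a m) * (1 / real (Suc i))" for i
    proof -
      have "a m * norm (P m (y (r i) - l)) \<le> a m * local_norm P m (y (r i) - l)"
        using am norm_P_le_local_norm[of m m] by (intro mult_left_mono) auto
      also have "\<dots> \<le> 1 / real (Suc i)"
        using le_strict_seminorm[OF a, of m "y (r i) - l"] small[of i] by linarith
      finally have "norm (P m (y (r i) - l)) \<le> 1 / real (Suc i) / a m"
        using am by (simp only: pos_le_divide_eq mult.commute)
      then show ?thesis by (simp add: blinfun.diff_right mult.commute)
    qed
    then show "\<forall>\<^sub>F i in sequentially. norm (P m (y (r i)) - P m l) \<le> (1 / a m) * (1 / real (Suc i))"
      by simp
  qed
  moreover have "bounded (range (\<lambda>i. y (r i)))"
    by (rule bounded_subset[OF bounded_if_strictly_compact[OF C]]) (use y in auto)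
  ultimately show ?thesis using r by (auto simp: strict_conv_iff)
qed

lemma uniformly_Montel_imp_subseq:
  assumes \<K>: "uniformly_Montel P \<K>" and K: "\<And>j::nat. K j \<in> \<K>" and x: "bounded (range x)"
  shows "\<exists>r l. strict_mono r \<and> strict_conv P (\<lambda>j. K (r j) (x (r j))) l"
proof (rule strictly_compact_imp_subseq)
  let ?S = "\<Union>K\<in>\<K>. blinfun_apply K ` range x"
  show "compactin (strict_topology P) (strict_topology P closure_of ?S)"
    using \<K> x by (simp add: uniformly_Montel_def)
  show "K j (x j) \<in> strict_topology P closure_of ?S" for j
  proof -
    have "?S \<subseteq> strict_topology P closure_of ?S" by (rule closure_of_subset) simp
    moreover have "K j (x j) \<in> ?S" using K by blast
    ultimately show ?thesis by blast
  qed
qed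

lemma uniformly_Montel_mono:
  assumes \<K>: "uniformly_Montel P \<K>" and sub: "\<L> \<subseteq> \<K>"
  shows "uniformly_Montel P \<L>"
  unfolding uniformly_Montel_def
proof (intro allI impI)
  fix S :: "'a set" assume "bounded S"
  then have "compactin (strict_topology P)
      (strict_topology P closure_of (\<Union>K\<in>\<K>. blinfun_apply K ` S))"
    using \<K> by (simp add: uniformly_Montel_def)
  then show "compactin (strict_topology P)
      (strict_topology P closure_of (\<Union>K\<in>\<L>. blinfun_apply K ` S))"
    by (rule closed_compactin) (use sub in \<open>auto intro!: closure_of_mono closedin_closure_of\<close>)
qed

text \<open>
  Strict convergence of operators tests sequences with matching indices. A sequence indexed along
  the subsequence is filled up with its limit at the other indices.
\<close>

lemma strict_op_conv_subseq:
  assumes T: "strict_op_conv P T B" and r: "strict_mono r"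
  shows "strict_op_conv P (\<lambda>j. T (r j)) B"
  unfolding strict_op_conv_def
proof (intro allI impI)
  fix x l assume x: "strict_conv P x l"
  define z where "z i = (if i \<in> range r then x (inv r i) else l)" for i
  have inj: "inj r" using r by (rule strict_mono_imp_inj_on)
  have z_r: "z (r j) = x j" for j by (simp add: z_def inj)
  have "strict_conv P z l"
    unfolding strict_conv_iff
  proof (intro conjI allI)
    have "range z \<subseteq> insert l (range x)" by (auto simp: z_def)
    moreover have "bounded (insert l (range x))" using x by (simp add: strict_conv_iff)
    ultimately show "bounded (range z)" by (metis bounded_subset)
    fix m
    show "(\<lambda>i. P m (z i)) \<longlonglongrightarrow> P m l"
    proof (rule LIMSEQ_I)
      fix e :: real assume e: "0 < e"
      have "(\<lambda>j. P m (x j)) \<longlonglongrightarrow> P m l" using x by (simp add: strict_conv_iff)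
      then obtain J where J: "\<And>j. j \<ge> J \<Longrightarrow> norm (P m (x j) - P m l) < e"
        using e LIMSEQ_D by blast
      have "norm (P m (z i) - P m l) < e" if i: "i \<ge> r J" for i
      proof (cases "i \<in> range r")
        case True
        then obtain j where j: "i = r j" by blast
        then have "J \<le> j" using i r by (simp add: strict_mono_less_eq)
        with J show ?thesis by (simp add: j z_r)
      next
        case False
        then show ?thesis using e by (simp add: z_def)
      qed
      then show "\<exists>N. \<forall>i\<ge>N. norm (P m (z i) - P m l) < e" by blast
    qed
  qed
  then have "strict_conv P (\<lambda>i. T i (z i)) (B l)" using T by (simp add: strict_op_conv_def)
  from strict_conv_subseq[OF this r] show "strict_conv P (\<lambda>j. T (r j) (x j)) (B l)"
    by (simp add: z_r)
qed

lemma strict_op_conv_unique: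
  assumes "strict_op_conv P T B" "strict_op_conv P T B'"
  shows "B = B'"
proof (rule blinfun_eqI)
  fix x
  show "B x = B' x"
    using assms strict_conv_const[of x] strict_conv_unique unfolding strict_op_conv_def by blast
qed

text \<open>
  Preimages \<open>x j\<close> of \<open>y\<close> under \<open>An j = id - Kn j\<close> satisfy \<open>x j = Kn j (x j) + y\<close>, so compactness of
  the \<open>Kn j\<close> turns bounded approximate solutions into a strictly convergent subsequence, whose limit
  solves the limiting equation. Its norm is controlled because norm balls are strictly closed; this
  yields surjectivity of the limit operator and the estimate of its inverse at once.
\<close>

lemma limit_preimage_bound:
  assumes An: "\<And>n. n \<ge> n0 \<Longrightarrow> An n = id_blinfun - Kn n"
    and a: "strict_op_conv P An A"
    and c: "uniformly_Montel P (Kn ` {n0..})"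
    and pre: "\<And>n. n \<ge> n0 \<Longrightarrow> \<exists>x. An n x = y \<and> norm x \<le> C"
  shows "\<exists>x. A x = y \<and> norm x \<le> C"
proof -
  have "\<forall>j. \<exists>x. An (n0 + j) x = y \<and> norm x \<le> C" using pre by simp
  then obtain x where Ax: "\<And>j. An (n0 + j) (x j) = y" and x_le: "\<And>j. norm (x j) \<le> C" by metis
  have x_eq: "x j = Kn (n0 + j) (x j) + y" for j
    using Ax[of j] An[of "n0 + j"] by (auto simp: blinfun.diff_left)
  have "bounded (range x)" using x_le by (auto intro: boundedI)
  from uniformly_Montel_imp_subseq[OF c _ this, of "\<lambda>j. Kn (n0 + j)"]
  obtain r l where r: "strict_mono r" and "strict_conv P (\<lambda>j. Kn (n0 + r j) (x (r j))) l"
    by auto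
  from strict_conv_add[OF this(2) strict_conv_const[of y]]
  have xl: "strict_conv P (\<lambda>j. x (r j)) (l + y)" by (simp flip: x_eq)
  have "strict_mono (\<lambda>j. n0 + r j)" using r by (simp add: strict_mono_def)
  from strict_op_conv_subseq[OF a this] xl
  have "strict_conv P (\<lambda>j. An (n0 + r j) (x (r j))) (A (l + y))" by (simp add: strict_op_conv_def)
  then have "strict_conv P (\<lambda>j. y) (A (l + y))" by (simp add: Ax)
  then have "A (l + y) = y" using strict_conv_const strict_conv_unique by blast
  moreover have "norm (l + y) \<le> C" using norm_strict_limit_le[OF xl] x_le by blast
  ultimately show ?thesis by blast
qed

end

section \<open>Inverses of bounded operators\<close>

lemma bounded_below_if_norm_ge:
  fixes A :: "'a::real_normed_vector \<Rightarrow>\<^sub>L 'a"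
  assumes "0 < c" "\<And>x. c * norm x \<le> norm (A x)"
  shows "bounded_below A"
proof -
  have "ereal c \<le> (INF x\<in>{x. norm x = 1}. ereal (norm (A x)))"
  proof (rule INF_greatest)
    fix x :: 'a assume "x \<in> {x. norm x = 1}"
    then show "ereal c \<le> ereal (norm (A x))" using assms(2)[of x] by simp
  qed
  moreover have "0 < ereal c" using assms(1) by simp
  ultimately show ?thesis unfolding bounded_below_def by (rule less_le_trans[rotated])
qed

lemma op_inverse_eq:
  assumes "is_op_inverse smul A B"
  shows "op_inverse smul A = B"
  unfolding op_inverse_def
proof (rule the_equality)
  show "is_op_inverse smul A B" by (rule assms)
  fix C assume C: "is_op_inverse smul A C"
  have "C = C o\<^sub>L (A o\<^sub>L B)" using assms by (auto simp: is_op_inverse_def intro: blinfun_eqI)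
  also have "\<dots> = (C o\<^sub>L A) o\<^sub>L B" by (rule blinfun_eqI) simp
  also have "\<dots> = B" using C by (auto simp: is_op_inverse_def intro: blinfun_eqI)
  finally show "C = B" .
qed

text \<open>
  The bound on preimages takes the place of the open mapping theorem and gives the norm estimate
  for the inverse as well.
\<close>

lemma op_inverse_if_preimage_bound:
  assumes A: "A \<in> bounded_ops smul" and C: "0 \<le> C" and inj: "inj (blinfun_apply A)"
    and pre: "\<And>y. \<exists>x. A x = y \<and> norm x \<le> C * norm y"
  shows "is_op_inverse smul A (op_inverse smul A) \<and> norm (op_inverse smul A) \<le> C"
proof -
  define f where "f = inv (blinfun_apply A)"
  have surj: "surj (blinfun_apply A)" using pre by (metis surjI)
  have Af: "A (f y) = y" for y unfolding f_def by (rule surj_f_inv_f[OF surj])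
  have fA: "f (A x) = x" for x unfolding f_def by (rule inv_f_f[OF inj])
  have le: "norm (f y) \<le> norm y * C" for y using pre[of y] fA by (auto simp: mult.commute)
  have eq: "x = y" if "A x = A y" for x y using inj that by (rule injD)
  have "bounded_linear f"
    by (rule bounded_linear_intro[where K = C])
      (simp_all add: eq le Af blinfun.add_right blinfun.scaleR_right)
  then have ap: "blinfun_apply (Blinfun f) = f" by (rule bounded_linear_Blinfun_apply)
  have "A (smul c x) = smul c (A x)" for c x using A by (simp add: bounded_ops_def)
  then have "A (f (smul c y)) = A (smul c (f y))" for c y by (simp add: Af)
  then have "f (smul c y) = smul c (f y)" for c y by (rule eq)
  then have "Blinfun f \<in> bounded_ops smul" by (simp add: bounded_ops_def ap)
  moreover have "A o\<^sub>L Blinfun f = id_blinfun" "Blinfun f o\<^sub>L A = id_blinfun"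
    by (rule blinfun_eqI, simp add: ap Af fA)+
  ultimately have "is_op_inverse smul A (Blinfun f)" by (simp add: is_op_inverse_def)
  moreover have "norm (Blinfun f) \<le> C"
    using C le by (intro norm_blinfun_bound) (auto simp: ap mult.commute)
  ultimately show ?thesis by (simp add: op_inverse_eq)
qed

section \<open>Stability for a sufficient isometry group\<close>

context isometry_group
begin

lemma V_minus: "V k (V (- k) x) = x" "V (- k) (V k x) = x"
  using V_add[of k "- k"] V_add[of "- k" k] V_zero
  by (metis add.right_inverse add.left_inverse blinfun_apply_blinfun_compose blinfun_apply_id_blinfun)+

text \<open>
  The limit operators in \<open>\<B>\<close> are injective but possibly not bounded below. This suffices, since
  compactness gives translated almost null vectors of \<open>An n\<close> a strict limit, in the kernel of such an
  operator, and sufficiency lets the translations be chosen so that this limit is nonzero.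
\<close>

lemma uniformly_bounded_below:
  assumes suff: "sufficient P V"
    and An: "\<And>n. n \<ge> 1 \<Longrightarrow> An n = id_blinfun - Kn n"
    and c: "uniformly_Montel P {V (- k) o\<^sub>L Kn n o\<^sub>L V k | k n. n \<ge> 1}"
    and d: "\<And>(k :: nat \<Rightarrow> int ^ 'n) (\<nu> :: nat \<Rightarrow> nat). \<lbrakk>strict_mono \<nu>; \<forall>m. \<nu> m \<ge> 1\<rbrakk> \<Longrightarrow>
        \<exists>(r :: nat \<Rightarrow> nat) B. strict_mono r \<and> B \<in> \<B> \<and>
          strict_op_conv P (\<lambda>m. V (- k (r m)) o\<^sub>L An (\<nu> (r m)) o\<^sub>L V (k (r m))) B"
    and e: "\<And>B. B \<in> \<B> \<Longrightarrow> inj (blinfun_apply B)"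
  shows "\<exists>c>0. \<exists>n0\<ge>1. \<forall>n\<ge>n0. \<forall>x. c * norm x \<le> norm (An n x)"
proof (rule ccontr)
  assume "\<not> ?thesis"
  then have neg: "\<exists>n\<ge>n0. \<exists>x. norm (An n x) < c * norm x" if "0 < c" "n0 \<ge> 1" for c n0
    using that by (meson not_le)
  have step: "\<exists>n\<ge>n0. \<exists>x. norm x = 1 \<and> norm (An n x) < c" if cn: "0 < c" "n0 \<ge> 1" for c n0
  proof -
    obtain n x where n: "n \<ge> n0" and x: "norm (An n x) < c * norm x" using neg[OF cn] by blast
    then have "x \<noteq> 0" by auto
    then have "norm (x /\<^sub>R norm x) = 1" "norm (An n (x /\<^sub>R norm x)) < c"
      using x by (auto simp: blinfun.scaleR_right field_simps)
    with n show ?thesis by blast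
  qed
  have "\<exists>\<nu>. \<forall>m. (\<nu> m \<ge> 1 \<and> (\<exists>x. norm x = 1 \<and> norm (An (\<nu> m) x) < 1 / real (Suc m))) \<and> \<nu> m < \<nu> (Suc m)"
  proof (rule dependent_nat_choice)
    show "\<exists>n. n \<ge> 1 \<and> (\<exists>x. norm x = 1 \<and> norm (An n x) < 1 / real (Suc 0))"
      using step[of "1 / real (Suc 0)" 1] by auto
    fix n m :: nat
    show "\<exists>n'. (n' \<ge> 1 \<and> (\<exists>x. norm x = 1 \<and> norm (An n' x) < 1 / real (Suc (Suc m)))) \<and> n < n'"
    proof -
      have "0 < 1 / real (Suc (Suc m))" "1 \<le> Suc n" by simp_all
      from step[OF this]
      obtain n' where "n' \<ge> Suc n" "\<exists>x. norm x = 1 \<and> norm (An n' x) < 1 / real (Suc (Suc m))"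
        by blast
      then show ?thesis by (intro exI[of _ n']) simp
    qed
  qed
  then obtain \<nu> where \<nu>1: "\<And>m. \<nu> m \<ge> 1" and \<nu>_step: "\<And>m. \<nu> m < \<nu> (Suc m)"
    and ex: "\<And>m. \<exists>x. norm x = 1 \<and> norm (An (\<nu> m) x) < 1 / real (Suc m)"
    by blast
  then obtain x where x1: "\<And>m. norm (x m) = 1"
    and small: "\<And>m. norm (An (\<nu> m) (x m)) < 1 / real (Suc m)"
    by metis
  have \<nu>: "strict_mono \<nu>" using \<nu>_step by (simp add: strict_mono_Suc_iff)
  obtain n where suff_n: "\<And>x. \<exists>k. norm x \<le> 2 * local_norm P n (V k x)"
    using suff unfolding sufficient_def by blast
  obtain \<kappa> where \<kappa>: "\<And>m. norm (x m) \<le> 2 * local_norm P n (V (\<kappa> m) (x m))"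
    using choice[of "\<lambda>m k. norm (x m) \<le> 2 * local_norm P n (V k (x m))"] suff_n by blast
  define y where "y m = V (\<kappa> m) (x m)" for m
  have y1: "norm (y m) = 1" for m by (simp add: y_def V_isometry x1)
  \<comment> \<open>The translations \<open>k\<close> of the compactness conditions are \<open>- \<kappa> m\<close>, as \<open>V (\<kappa> m)\<close> brings \<open>x m\<close> back.\<close>
  define T where "T m = V (- (- \<kappa> m)) o\<^sub>L An (\<nu> m) o\<^sub>L V (- \<kappa> m)" for m
  define C where "C m = V (- (- \<kappa> m)) o\<^sub>L Kn (\<nu> m) o\<^sub>L V (- \<kappa> m)" for m
  have T_y: "T m (y m) = V (\<kappa> m) (An (\<nu> m) (x m))" for m
    by (simp add: T_def y_def V_minus)
  have y_split: "y m = C m (y m) + T m (y m)" for m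
    by (simp add: T_def C_def y_def V_minus An[OF \<nu>1] blinfun.diff_left blinfun.diff_right)
  obtain r B where r: "strict_mono r" and B: "B \<in> \<B>" and TB: "strict_op_conv P (\<lambda>m. T (r m)) B"
    using d[OF \<nu>, of "\<lambda>m. - \<kappa> m"] \<nu>1 unfolding T_def by blast
  have C_mem: "C m \<in> {V (- k) o\<^sub>L Kn n o\<^sub>L V k | k n. n \<ge> 1}" for m
    unfolding C_def using \<nu>1 by blast
  have "bounded (range (\<lambda>m. y (r m)))" by (rule boundedI[where B = 1]) (auto simp: y1)
  from uniformly_Montel_imp_subseq[OF c C_mem this]
  obtain s l where s: "strict_mono s" and l: "strict_conv P (\<lambda>m. C (r (s m)) (y (r (s m)))) l"
    by blast
  define q where "q m = r (s m)" for m
  have q: "strict_mono q" using strict_mono_o[OF r s] by (simp add: o_def q_def[abs_def])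
  have "(\<lambda>m. T m (y m)) \<longlonglongrightarrow> 0"
  proof (rule Lim_null_comparison[OF _ LIMSEQ_Suc[OF lim_1_over_n]])
    show "\<forall>\<^sub>F m in sequentially. norm (T m (y m)) \<le> 1 / real (Suc m)"
      using small by (simp add: T_y V_isometry less_imp_le)
  qed
  then have Ty0: "strict_conv P (\<lambda>m. T (q m) (y (q m))) 0"
    by (intro strict_conv_subseq[OF _ q] strict_conv_if_norm_conv)
  have "strict_conv P (\<lambda>m. C (q m) (y (q m)) + T (q m) (y (q m))) (l + 0)"
    using l Ty0 by (intro strict_conv_add) (simp_all add: q_def)
  then have yl: "strict_conv P (\<lambda>m. y (q m)) l" by (simp flip: y_split)
  have "strict_op_conv P (\<lambda>m. T (q m)) B"
    using strict_op_conv_subseq[OF TB s] by (simp add: q_def)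
  then have "strict_conv P (\<lambda>m. T (q m) (y (q m))) (B l)"
    using yl by (simp add: strict_op_conv_def)
  then have "B l = 0" using Ty0 strict_conv_unique by blast
  then have "l = 0" using injD[OF e[OF B], of l 0] by simp
  then have "(\<lambda>m. local_norm P n (y (q m))) \<longlonglongrightarrow> 0"
    using yl by (intro local_norm_tendsto_zero) (simp add: strict_conv_iff)
  moreover have "1 / 2 \<le> local_norm P n (y (q m))" for m
    using \<kappa>[of "q m"] x1 by (simp add: y_def)
  ultimately show False using LIMSEQ_le_const[of "\<lambda>m. local_norm P n (y (q m))" 0 "1/2"] by auto
qed

end

theorem theorem5p20:
  fixes smul :: "'k::real_normed_field \<Rightarrow> 'a::banach \<Rightarrow> 'a"
    and P :: "nat \<Rightarrow> 'a \<Rightarrow>\<^sub>L 'a"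
    and V :: "int ^ 'n::finite \<Rightarrow> 'a \<Rightarrow>\<^sub>L 'a"
    and A K :: "'a \<Rightarrow>\<^sub>L 'a"
    and An Kn :: "nat \<Rightarrow> 'a \<Rightarrow>\<^sub>L 'a"
    and \<B> :: "('a \<Rightarrow>\<^sub>L 'a) set"
  assumes setting: "isometry_group smul P V"
    and complete: "equals_hat_space P"
    and suff: "sufficient P V"
    and A: "A = id_blinfun - K" "A \<in> bounded_ops smul"
    and An: "\<And>n. n \<ge> 1 \<Longrightarrow> An n = id_blinfun - Kn n"
      "\<And>n. n \<ge> 1 \<Longrightarrow> An n \<in> bounded_ops smul"
    and a: "strict_op_conv P An A"
    and b: "\<And>n. \<lbrakk>n \<ge> 1; bounded_below (An n)\<rbrakk> \<Longrightarrow> surj (blinfun_apply (An n))"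
    and c: "uniformly_Montel P {V (- k) o\<^sub>L Kn n o\<^sub>L V k | k n. n \<ge> 1}"
    and d: "\<B> \<subseteq> bounded_ops smul"
      "\<And>(k :: nat \<Rightarrow> int ^ 'n) (\<nu> :: nat \<Rightarrow> nat). \<lbrakk>strict_mono \<nu>; \<forall>m. \<nu> m \<ge> 1\<rbrakk> \<Longrightarrow>
        \<exists>(r :: nat \<Rightarrow> nat) B. strict_mono r \<and> B \<in> \<B> \<and>
          strict_op_conv P (\<lambda>m. V (- k (r m)) o\<^sub>L An (\<nu> (r m)) o\<^sub>L V (k (r m))) B"
    and e: "\<And>B. B \<in> \<B> \<Longrightarrow> inj (blinfun_apply B)"
  shows "op_invertible smul A \<and>
    (\<exists>n0\<ge>1. (\<forall>n\<ge>n0. op_invertible smul (An n)) \<and>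
      ereal (norm (op_inverse smul A)) \<le> (SUP n\<in>{n0..}. ereal (norm (op_inverse smul (An n)))) \<and>
      (SUP n\<in>{n0..}. ereal (norm (op_inverse smul (An n)))) < \<infinity>)"
proof -
  interpret isometry_group smul P V by (rule setting)
  obtain \<gamma> n0 where \<gamma>: "0 < \<gamma>" and n0: "n0 \<ge> 1"
    and below: "\<And>n x. n \<ge> n0 \<Longrightarrow> \<gamma> * norm x \<le> norm (An n x)"
    using uniformly_bounded_below[OF suff An(1) c d(2) e] by blast
  let ?inv = "\<lambda>n. op_inverse smul (An n)"
  have inv: "is_op_inverse smul (An n) (?inv n) \<and> norm (?inv n) \<le> 1 / \<gamma>" if n: "n \<ge> n0" for n
  proof (rule op_inverse_if_preimage_bound)
    show "An n \<in> bounded_ops smul" using An(2) n n0 by simp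
    show "inj (blinfun_apply (An n))"
    proof (rule injI)
      fix x y assume "An n x = An n y"
      then have "\<gamma> * norm (x - y) \<le> 0"
        using below[OF n, of "x - y"] by (simp add: blinfun.diff_right)
      then show "x = y" using \<gamma> by (simp add: mult_le_0_iff)
    qed
    have "surj (blinfun_apply (An n))"
      using b[of n] n n0 bounded_below_if_norm_ge[OF \<gamma> below[OF n]] by simp
    then show "\<exists>x. An n x = y \<and> norm x \<le> 1 / \<gamma> * norm y" for y
    proof -
      obtain x where x: "y = An n x"
        using \<open>surj (blinfun_apply (An n))\<close> by (rule surjE)
      then have "norm x \<le> 1 / \<gamma> * norm y"
        using below[OF n, of x] \<gamma> by (simp add: field_simps)
      with x show ?thesis by blast
    qed
  qed (use \<gamma> in simp)
  let ?sup = "SUP n\<in>{n0..}. ereal (norm (?inv n))"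
  have le_sup: "ereal (norm (?inv n)) \<le> ?sup" if "n \<ge> n0" for n
    using that by (intro SUP_upper) simp
  have "?sup \<le> ereal (1 / \<gamma>)" using inv by (intro SUP_least) simp
  moreover have "ereal 0 \<le> ?sup" using le_sup[of n0] norm_ge_zero[of "?inv n0"]
    by (metis ereal_less_eq(3) order_refl order_trans)
  ultimately obtain S where S_eq: "?sup = ereal S" by (cases ?sup) simp_all
  have le_S: "norm (?inv n) \<le> S" if "n \<ge> n0" for n
    using le_sup[OF that] unfolding S_eq by simp
  have S_nonneg: "0 \<le> S" using le_S[of n0] norm_ge_zero order_trans by blast
  have untranslated: "V (- 0) o\<^sub>L T o\<^sub>L V 0 = T" for T
    by (rule blinfun_eqI) (simp add: V_zero)
  \<comment> \<open>Without translations, the limit operator that the compactness of the family provides can only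
    be \<open>A\<close> itself; hence \<open>A\<close> is one of the injective operators in \<open>\<B>\<close>.\<close>
  have inj: "inj (blinfun_apply A)"
  proof -
    obtain r B where r: "strict_mono r" and B: "B \<in> \<B>"
      and conv: "strict_op_conv P (\<lambda>m. V (- 0) o\<^sub>L An (Suc (r m)) o\<^sub>L V 0) B"
      using d(2)[of Suc "\<lambda>_. 0"] by (auto simp: strict_mono_Suc_iff)
    have "strict_op_conv P (\<lambda>m. An (Suc (r m))) B"
      using conv unfolding untranslated .
    moreover have "strict_op_conv P (\<lambda>m. An (Suc (r m))) A"
      by (rule strict_op_conv_subseq[OF a]) (use r in \<open>simp add: strict_mono_def\<close>)
    ultimately have "B = A" by (rule strict_op_conv_unique)
    then show ?thesis using e[OF B] by simp
  qed
  have A_inv: "is_op_inverse smul A (op_inverse smul A) \<and> norm (op_inverse smul A) \<le> S"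
  proof (rule op_inverse_if_preimage_bound[OF A(2) S_nonneg inj])
    fix y
    show "\<exists>x. A x = y \<and> norm x \<le> S * norm y"
    proof (rule limit_preimage_bound[OF _ a])
      show "An n = id_blinfun - Kn n" if "n \<ge> n0" for n using An(1) that n0 by simp
      have "Kn ` {n0..} \<subseteq> {V (- k) o\<^sub>L Kn n o\<^sub>L V k | k n. n \<ge> 1}"
      proof
        fix T assume "T \<in> Kn ` {n0..}"
        then obtain n where "n \<ge> n0" "T = Kn n" by auto
        then have "n \<ge> 1" "T = V (- 0) o\<^sub>L Kn n o\<^sub>L V 0"
          unfolding untranslated using n0 by simp_all
        then show "T \<in> {V (- k) o\<^sub>L Kn n o\<^sub>L V k | k n. n \<ge> 1}" by blast
      qed
      then show "uniformly_Montel P (Kn ` {n0..})" using c by (rule uniformly_Montel_mono[rotated])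
      fix n assume n: "n \<ge> n0"
      have "An n (?inv n y) = y"
        using inv[OF n] unfolding is_op_inverse_def
        by (metis blinfun_apply_blinfun_compose blinfun_apply_id_blinfun)
      moreover have "norm (?inv n y) \<le> S * norm y"
        using norm_blinfun[of "?inv n" y] mult_right_mono[OF le_S[OF n] norm_ge_zero[of y]]
        by (rule order_trans)
      ultimately show "\<exists>x. An n x = y \<and> norm x \<le> S * norm y" by blast
    qed
  qed
  show ?thesis
  proof (intro conjI exI[of _ n0] n0)
    show "op_invertible smul A" using A_inv by (auto simp: op_invertible_def)
    show "\<forall>n\<ge>n0. op_invertible smul (An n)" using inv by (auto simp: op_invertible_def)
    show "ereal (norm (op_inverse smul A)) \<le> (SUP n\<in>{n0..}. ereal (norm (?inv n)))"
      unfolding S_eq using A_inv by simp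
    show "(SUP n\<in>{n0..}. ereal (norm (?inv n))) < \<infinity>" unfolding S_eq by simp
  qed
qed

end
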